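(* Let $n\ge m>0$ and let $E_D:\{0,1\}^n\times\{0,1\}^n\to\{0,1\}^m$ be the DEOR-extractor, $E_D(x,y)=(A_1x\cdot y,\dots,A_mx\cdot y)$, where $A_1,\dots,A_m$ are $n\times n$ matrices over $GF(2)$ such that $\sum_{i\in S}A_i$ has full rank for every nonempty $S\subseteq[m]$. If $k_1+k_2\ge 6m+n-2+6\log\varepsilon^{-1}$, then $E_D$ is a $(k_1,k_2,\varepsilon)$ X-strong extractor against quantum knowledge, and likewise a $(k_1,k_2,\varepsilon)$ Y-strong extractor against quantum knowledge.
   Context: Logarithms are base 2. $u\cdot v=\sum_ju_jv_j\bmod2$. For a matrix $M$, $|M|_{\mathrm{tr}}=\frac12\mathrm{Tr}\sqrt{M^\dagger M}$. $U_m$ is the uniform distribution on $\{0,1\}^m$ (identified with the maximally mixed state). Guessing entropy: $H_g(X\leftarrow\rho_X)=-\log\max_M\mathbb{E}_{x\leftarrow X}[\mathrm{Tr}(M_x\rho_x)]$, the maximum being over all POVMs $M=\{M_x\}$ indexed by the values of $X$. $E:\{0,1\}^n\times\{0,1\}^n\to\{0,1\}^m$ is a $(k_1,k_2,\varepsilon)$ X-strong extractor against quantum knowledge if for all independent $n$-bit sources $X,Y$ and all families of density matrices $\{\rho_x\},\{\rho_y\}$ with $H_g(X\leftarrow\rho_X)\ge k_1$ and $H_g(Y\leftarrow\rho_Y)\ge k_2$, $$\Big|\sum_{x,y}p(x)p(y)\,|E(x,y)\rangle\langle E(x,y)|\otimes\rho_y\otimes|x\rangle\langle x|-U_m\otimes\sum_{x,y}p(x)p(y)\,\rho_y\otimes|x\rangle\langle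 x|\Big|_{\mathrm{tr}}\le\varepsilon .$$ Y-strong is defined symmetrically, with $\rho_x\otimes|y\rangle\langle y|$ in place of $\rho_y\otimes|x\rangle\langle x|$. *)

theory Defs
  imports "HOL-Probability.Probability" "HOL-Library.Z2" "HOL-Library.Nonpos_Ints"
begin

instance bit :: finite
proof
  have "(UNIV :: bit set) \<subseteq> {0, 1}"
    by (metis bit_not_one_iff insertCI subsetI)
  then show "finite (UNIV :: bit set)"
    using finite_subset by blast
qed

text \<open>
  A complex matrix indexed by a finite type \<open>'a\<close> is an operator on the Hilbert space with
  orthonormal basis indexed by \<open>'a\<close>.  The set of \<open>n\<close>-bit strings is the type
  \<open>bit^'n\<close> with \<open>n = CARD('n)\<close>, so \<open>complex^(bit^'n)^(bit^'n)\<close> holds the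
  operators on \<open>n\<close> qubits.
\<close>

definition dagger :: "complex^'a^'b \<Rightarrow> complex^'b^'a" where
  "dagger M = (\<chi> i j. cnj (M $ j $ i))"

text \<open>Over the complex numbers, nonnegativity of the quadratic form already forces \<open>M\<close> to be
  Hermitian, since \<open>\<real>\<^sub>\<ge>\<^sub>0\<close> contains only (embedded) real numbers.\<close>

definition psd :: "complex^'a^'a \<Rightarrow> bool" where
  "psd M \<longleftrightarrow> (\<forall>v. (\<Sum>i\<in>UNIV. cnj (v $ i) * (M *v v) $ i) \<in> \<real>\<^sub>\<ge>\<^sub>0)"

definition density_matrix :: "complex^'a^'a \<Rightarrow> bool" where
  "density_matrix \<rho> \<longleftrightarrow> psd \<rho> \<and> trace \<rho> = 1"

definition matrix_sqrt :: "complex^'a^'a \<Rightarrow> complex^'a^'a" where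
  "matrix_sqrt M = (THE R. psd R \<and> R ** R = M)"

text \<open>The trace norm carries the factor \<open>1/2\<close>, so that the norm of a difference of density
  matrices is their trace distance.\<close>

definition trace_norm :: "complex^'a^'a \<Rightarrow> real" where
  "trace_norm M = 1/2 * Re (trace (matrix_sqrt (dagger M ** M)))"

definition tensor :: "complex^'a^'a \<Rightarrow> complex^'b^'b \<Rightarrow> complex^('a \<times> 'b)^('a \<times> 'b)"
    (infixr \<open>\<otimes>\<close> 75) where
  "M \<otimes> N = (\<chi> i j. M $ fst i $ fst j * N $ snd i $ snd j)"

definition ketbra :: "'a \<Rightarrow> complex^'a^'a" where
  "ketbra x = (\<chi> i j. if i = x \<and> j = x then 1 else 0)"

definition maximally_mixed :: "complex^'a^'a" where
  "maximally_mixed = (1 / real CARD('a)) *\<^sub>R mat 1"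

definition POVM :: "('x::finite \<Rightarrow> complex^'a^'a) \<Rightarrow> bool" where
  "POVM M \<longleftrightarrow> (\<forall>x. psd (M x)) \<and> (\<Sum>x\<in>UNIV. M x) = mat 1"

text \<open>The supremum is a maximum, the set of POVMs being compact and the guessing probability
  continuous.\<close>

definition guessing_entropy :: "'x::finite pmf \<Rightarrow> ('x \<Rightarrow> complex^'a^'a) \<Rightarrow> real" where
  "guessing_entropy X \<rho> =
     - log 2 (SUP M\<in>{M. POVM M}. measure_pmf.expectation X (\<lambda>x. Re (trace (M x ** \<rho> x))))"

text \<open>
  The type arguments \<open>'a\<close> and \<open>'b\<close> give the dimensions of the side information about the two
  sources.  To be an extractor against quantum knowledge means to satisfy the predicate for
  all finite types \<open>'a\<close> and \<open>'b\<close>.  Independence of the sources is expressed by taking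
  the product of their distributions.
\<close>

definition X_strong_extractor ::
  "'a::finite itself \<Rightarrow> 'b::finite itself \<Rightarrow> real \<Rightarrow> real \<Rightarrow> real \<Rightarrow>
    (bit^'n \<Rightarrow> bit^'n \<Rightarrow> bit^'m) \<Rightarrow> bool" where
  "X_strong_extractor _ _ k1 k2 \<epsilon> E \<longleftrightarrow>
     (\<forall>(X :: (bit^'n) pmf) (Y :: (bit^'n) pmf)
        (\<rho>X :: bit^'n \<Rightarrow> complex^'a^'a) (\<rho>Y :: bit^'n \<Rightarrow> complex^'b^'b).
        (\<forall>x. density_matrix (\<rho>X x)) \<longrightarrow> (\<forall>y. density_matrix (\<rho>Y y)) \<longrightarrow>
        guessing_entropy X \<rho>X \<ge> k1 \<longrightarrow> guessing_entropy Y \<rho>Y \<ge> k2 \<longrightarrow>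
        trace_norm
          ((\<Sum>x\<in>UNIV. \<Sum>y\<in>UNIV. (pmf X x * pmf Y y) *\<^sub>R (ketbra (E x y) \<otimes> \<rho>Y y \<otimes> ketbra x)) -
           maximally_mixed \<otimes>
             (\<Sum>x\<in>UNIV. \<Sum>y\<in>UNIV. (pmf X x * pmf Y y) *\<^sub>R (\<rho>Y y \<otimes> ketbra x))) \<le> \<epsilon>)"

definition Y_strong_extractor ::
  "'a::finite itself \<Rightarrow> 'b::finite itself \<Rightarrow> real \<Rightarrow> real \<Rightarrow> real \<Rightarrow>
    (bit^'n \<Rightarrow> bit^'n \<Rightarrow> bit^'m) \<Rightarrow> bool" where
  "Y_strong_extractor _ _ k1 k2 \<epsilon> E \<longleftrightarrow>
     (\<forall>(X :: (bit^'n) pmf) (Y :: (bit^'n) pmf)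
        (\<rho>X :: bit^'n \<Rightarrow> complex^'a^'a) (\<rho>Y :: bit^'n \<Rightarrow> complex^'b^'b).
        (\<forall>x. density_matrix (\<rho>X x)) \<longrightarrow> (\<forall>y. density_matrix (\<rho>Y y)) \<longrightarrow>
        guessing_entropy X \<rho>X \<ge> k1 \<longrightarrow> guessing_entropy Y \<rho>Y \<ge> k2 \<longrightarrow>
        trace_norm
          ((\<Sum>x\<in>UNIV. \<Sum>y\<in>UNIV. (pmf X x * pmf Y y) *\<^sub>R (ketbra (E x y) \<otimes> \<rho>X x \<otimes> ketbra y)) -
           maximally_mixed \<otimes>
             (\<Sum>x\<in>UNIV. \<Sum>y\<in>UNIV. (pmf X x * pmf Y y) *\<^sub>R (\<rho>X x \<otimes> ketbra y))) \<le> \<epsilon>)"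

definition DEOR :: "('m \<Rightarrow> bit^'n^'n) \<Rightarrow> bit^'n \<Rightarrow> bit^'n \<Rightarrow> bit^'m" where
  "DEOR A x y = (\<chi> i. scalar_product (A i *v x) y)"

end

theory Submission
  imports Defs
begin

text \<open>
  The trace norm of the Hermitian operator \<open>D\<close> measuring the distance from uniform is
  \<open>1/2 Tr (T D)\<close> for a Hermitian contraction \<open>T\<close>.  Expanding the indicator of \<open>E x y = z\<close> in the
  characters of \<open>GF(2)\<^sup>m\<close> turns \<open>Tr (T D)\<close> into a sum, over the nonempty \<open>S\<close>, of
  \<open>\<Sum>\<^sub>y q\<^sub>y Tr (F\<^sub>y \<rho>\<^sub>y)\<close> with \<open>F\<^sub>y = \<Sum>\<^sub>x p\<^sub>x \<chi>\<^sub>S (E x y) T\<^sub>x\<close>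
  and Hermitian contractions \<open>T\<^sub>x\<close>.  By Cauchy--Schwarz its square is at most
  \<open>\<Sum>\<^sub>y q\<^sub>y Tr (F\<^sub>y\<^sup>2 \<rho>\<^sub>y)\<close>.  Because the matrix
  \<open>\<chi>\<^sub>S (E x y)\<close> has orthogonal rows, Parseval shows that the operators \<open>F\<^sub>y\<^sup>2 / 2\<^bsup>n - k\<^sub>1\<^esup>\<close> sum to at
  most the identity; they can therefore be completed to a POVM guessing \<open>Y\<close>, so the last sum is at
  most \<open>2\<^bsup>n - k\<^sub>1 - k\<^sub>2\<^esup>\<close>.  This gives the error bound \<open>2\<^bsup>m - 1\<^esup> 2\<^bsup>(n - k\<^sub>1 - k\<^sub>2) / 2\<^esup>\<close>,
  hence at most \<open>\<epsilon>\<^sup>3 / 2\<^bsup>2m\<^esup>\<close>.  For \<open>\<epsilon> > 2\<^sup>m\<close> it is enough that the \<open>F\<^sub>y\<close> are contractions.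
\<close>

section \<open>Hermitian matrices\<close>

text \<open>On \<open>complex^'a\<close> the operation \<open>\<bullet>\<close> is only the real
  part of this Hermitian form, which is antilinear in its first argument. Complex orthogonality
  needs the full form; quadratic forms of Hermitian matrices are real, so \<open>\<bullet>\<close>
  serves for them.\<close>

definition cinner :: "complex^'a \<Rightarrow> complex^'a \<Rightarrow> complex" where
  "cinner u v = (\<Sum>i\<in>UNIV. cnj (u $ i) * v $ i)"

abbreviation hermitian :: "complex^'a^'a \<Rightarrow> bool" where
  "hermitian M \<equiv> dagger M = M"

lemma Re_cinner: "Re (cinner u v) = u \<bullet> v"
  by (simp add: cinner_def inner_vec_def inner_complex_def)

lemma cinner_commute: "cnj (cinner u v) = cinner v u"
  by (simp add: cinner_def mult.commute)

lemma cinner_self: "cinner v v = of_real ((norm v)\<^sup>2)"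
proof (rule complex_eqI)
  show "Im (cinner v v) = Im (of_real ((norm v)\<^sup>2))"
    by (simp add: cinner_def mult.commute)
qed (simp add: Re_cinner power2_norm_eq_inner)

lemma cinner_add_right: "cinner u (v + w) = cinner u v + cinner u w"
  and cinner_add_left: "cinner (u + v) w = cinner u w + cinner v w"
  and cinner_diff_right: "cinner u (v - w) = cinner u v - cinner u w"
  and cinner_scale_right: "cinner u (c *s v) = c * cinner u v"
  and cinner_scale_left: "cinner (c *s u) v = cnj c * cinner u v"
  and cinner_scaleR_right: "cinner u (r *\<^sub>R v) = r * cinner u v"
  and cinner_zero_right: "cinner u 0 = 0"
  by (simp_all add: cinner_def algebra_simps sum.distrib sum_subtractf sum_distrib_left
      scaleR_conv_of_real[where 'a = complex])

lemma cinner_sum_right: "cinner u (\<Sum>k\<in>K. f k) = (\<Sum>k\<in>K. cinner u (f k))"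
  by (induction K rule: infinite_finite_induct) (simp_all add: cinner_add_right cinner_zero_right)

lemma cinner_dagger: "cinner (dagger M *v u) v = cinner u (M *v v)"
proof -
  have "cinner (dagger M *v u) v = (\<Sum>i\<in>UNIV. \<Sum>j\<in>UNIV. M $ j $ i * cnj (u $ j) * v $ i)"
    by (simp add: cinner_def matrix_vector_mult_def dagger_def sum_distrib_right)
  also have "\<dots> = (\<Sum>j\<in>UNIV. \<Sum>i\<in>UNIV. M $ j $ i * cnj (u $ j) * v $ i)"
    by (rule sum.swap)
  also have "\<dots> = cinner u (M *v v)"
    by (simp add: cinner_def matrix_vector_mult_def sum_distrib_left mult_ac)
  finally show ?thesis .
qed

lemma dagger_mult: "dagger (M ** N) = dagger N ** dagger M"
  by (simp add: dagger_def matrix_matrix_mult_def vec_eq_iff mult.commute)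

lemma dagger_add: "dagger (M + N) = dagger M + dagger N"
  and dagger_diff: "dagger (M - N) = dagger M - dagger N"
  and dagger_scaleR: "dagger (r *\<^sub>R M) = r *\<^sub>R dagger M"
  and dagger_zero [simp]: "dagger 0 = 0"
  by (simp_all add: dagger_def vec_eq_iff)

lemma dagger_mat_1 [simp]: "dagger (mat 1) = mat 1"
  by (auto simp: dagger_def mat_def vec_eq_iff)

lemma dagger_sum: "dagger (\<Sum>k\<in>K. f k) = (\<Sum>k\<in>K. dagger (f k))"
  by (induction K rule: infinite_finite_induct) (simp_all add: dagger_add)

lemma matrix_vector_mult_sum_left: "(\<Sum>k\<in>K. f k) *v v = (\<Sum>k\<in>K. f k *v v)"
  by (induction K rule: infinite_finite_induct) (simp_all add: matrix_vector_mult_add_rdistrib)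

lemma matrix_mult_sum_left: "(\<Sum>k\<in>K. f k) ** N = (\<Sum>k\<in>K. f k ** N)"
  for f :: "'k \<Rightarrow> complex^'a^'b" and N :: "complex^'c^'a"
  by (induction K rule: infinite_finite_induct)
     (simp_all add: matrix_matrix_mult_def vec_eq_iff distrib_right sum.distrib)

lemma matrix_mult_sum_right: "N ** (\<Sum>k\<in>K. f k) = (\<Sum>k\<in>K. N ** f k)"
  for f :: "'k \<Rightarrow> complex^'a^'b" and N :: "complex^'b^'c"
  by (induction K rule: infinite_finite_induct)
     (simp_all add: matrix_matrix_mult_def vec_eq_iff distrib_left sum.distrib)

lemma matrix_mult_scaleR_left: "(r *\<^sub>R M) ** N = r *\<^sub>R (M ** N)"
  and matrix_mult_scaleR_right: "M ** (r *\<^sub>R N) = r *\<^sub>R (M ** N)"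
  for M :: "complex^'a^'b" and N :: "complex^'c^'a"
  by (simp_all add: matrix_matrix_mult_def vec_eq_iff scaleR_sum_right)

lemma matrix_mult_add_left: "(M + M') ** N = M ** N + M' ** N"
  and matrix_mult_diff_left: "(M - M') ** N = M ** N - M' ** N"
  and matrix_mult_diff_right: "N ** (M - M') = N ** M - N ** M'"
  for M M' N :: "complex^'a^'a"
  by (simp_all add: matrix_matrix_mult_def vec_eq_iff algebra_simps sum_subtractf sum.distrib)

lemma scaleR_matrix_vector: "(r *\<^sub>R M) *v v = r *\<^sub>R (M *v v)"
  for M :: "complex^'a^'b"
  by (simp add: matrix_vector_mult_def vec_eq_iff scaleR_sum_right)

lemma matrix_vector_scaleR: "M *v (r *\<^sub>R v) = r *\<^sub>R (M *v v)"
  for M :: "complex^'a^'b"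
  by (simp add: matrix_vector_mult_def vec_eq_iff scaleR_sum_right)

lemma trace_scaleR: "trace (r *\<^sub>R M) = r *\<^sub>R trace M" for M :: "complex^'a^'a"
  by (simp add: trace_def scaleR_sum_right)

lemma trace_sum: "trace (\<Sum>k\<in>K. f k) = (\<Sum>k\<in>K. trace (f k))"
  for f :: "'k \<Rightarrow> complex^'a^'a"
  by (induction K rule: infinite_finite_induct) (simp_all add: trace_add, simp_all add: trace_def)

lemma hermitian_cinner: "hermitian M \<Longrightarrow> cinner (M *v u) v = cinner u (M *v v)"
  by (metis cinner_dagger)

lemma hermitian_inner: "hermitian M \<Longrightarrow> (M *v u) \<bullet> v = u \<bullet> (M *v v)"
  by (metis hermitian_cinner Re_cinner)

lemma psd_alt: "psd M \<longleftrightarrow> (\<forall>v. cinner v (M *v v) \<in> \<real>\<^sub>\<ge>\<^sub>0)"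
  by (simp add: psd_def cinner_def)

text \<open>Polarisation: reality of the form at \<open>u + v\<close> makes the imaginary parts of
  \<open>?q u v\<close> and \<open>?q v u\<close> opposite, reality at \<open>u + \<i> *s v\<close>
  makes their real parts equal. Basis vectors then read off the entries.\<close>

lemma psd_imp_hermitian:
  fixes M :: "complex^'a^'a"
  assumes "psd M"
  shows "hermitian M"
proof -
  have real: "Im (cinner v (M *v v)) = 0" for v
    using assms by (simp add: psd_alt complex_nonneg_Reals_iff)
  let ?q = "\<lambda>u v. cinner u (M *v v)"
  have sym: "?q u v = cnj (?q v u)" for u v
  proof -
    have "Im (?q (u + v) (u + v)) = Im (?q u u) + Im (?q u v) + Im (?q v u) + Im (?q v v)"
      by (simp add: cinner_add_left cinner_add_right matrix_vector_right_distrib)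
    then have im: "Im (?q u v) + Im (?q v u) = 0"
      by (simp add: real)
    have "?q (u + \<i> *s v) (u + \<i> *s v) = ?q u u + \<i> * ?q u v - \<i> * ?q v u + ?q v v"
      by (simp add: cinner_add_left cinner_add_right matrix_vector_right_distrib
          cinner_scale_left cinner_scale_right vector_scalar_commute algebra_simps)
    then have "Im (?q (u + \<i> *s v) (u + \<i> *s v)) = Re (?q u v) - Re (?q v u)"
      by (simp add: real)
    then have "Re (?q u v) - Re (?q v u) = 0"
      by (simp add: real)
    with im show ?thesis
      by (simp add: complex_eq_iff)
  qed
  have entry: "?q (axis i 1) (axis j 1) = M $ i $ j" for i j
  proof -
    have "M *v axis j 1 = (\<chi> i. M $ i $ j)"
      by (simp add: matrix_vector_mult_def axis_def vec_eq_iff if_distrib cong: if_cong)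
    then show ?thesis
      by (simp add: cinner_def axis_def if_distrib[of cnj] if_distrib[of "\<lambda>x. x * _"] cong: if_cong)
  qed
  show ?thesis
    unfolding dagger_def vec_eq_iff vec_lambda_beta by (metis entry sym)
qed

lemma psd_iff: "psd M \<longleftrightarrow> hermitian M \<and> (\<forall>v. 0 \<le> v \<bullet> (M *v v))"
proof (intro iffI conjI allI)
  assume *: "hermitian M \<and> (\<forall>v. 0 \<le> v \<bullet> (M *v v))"
  have "Im (cinner v (M *v v)) = 0" for v
    using * hermitian_cinner[of M v v] cinner_commute[of v "M *v v"]
    by (metis complex_is_Real_iff Reals_cnj_iff)
  then show "psd M"
    using * by (simp add: psd_alt complex_nonneg_Reals_iff Re_cinner)
qed (auto simp: psd_imp_hermitian psd_alt complex_nonneg_Reals_iff Re_cinner)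

section \<open>Spectral theorem\<close>

text \<open>The rank-one operator \<open>|b><b|\<close>, an orthogonal projection when
  \<open>b\<close> is a unit vector.\<close>

definition outer :: "complex^'a \<Rightarrow> complex^'a^'a" where
  "outer b = (\<chi> i j. b $ i * cnj (b $ j))"

lemma outer_mult_vec: "outer b *v v = cinner b v *s b"
  by (simp add: outer_def matrix_vector_mult_def cinner_def vec_eq_iff sum_distrib_right
      sum_distrib_left mult_ac)

lemma hermitian_outer: "hermitian (outer b)"
  by (simp add: outer_def dagger_def vec_eq_iff mult.commute)

lemma trace_mult_outer: "trace (A ** outer b) = cinner b (A *v b)"
  by (simp add: trace_def matrix_matrix_mult_def outer_def cinner_def matrix_vector_mult_def
      sum_distrib_left mult_ac)

definition orthonormal :: "(complex^'a) set \<Rightarrow> bool" where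
  "orthonormal B \<longleftrightarrow> finite B \<and> (\<forall>b\<in>B. \<forall>c\<in>B. cinner b c = (if b = c then 1 else 0))"

lemma orthonormal_card:
  fixes B :: "(complex^'a) set"
  assumes "orthonormal B"
  shows "card B \<le> DIM(complex^'a)"
proof -
  have "pairwise orthogonal B"
    unfolding pairwise_def orthogonal_def
    using assms by (metis Re_cinner orthonormal_def zero_complex.sel(1))
  moreover have "0 \<notin> B"
    using assms by (auto simp: orthonormal_def cinner_zero_right dest!: bspec[of _ _ 0])
  ultimately show ?thesis
    using pairwise_orthogonal_independent independent_bound by blast
qed

text \<open>Maximising the Rayleigh quotient on the unit sphere of the orthogonal complement.\<close>

lemma hermitian_eigenvector_orthogonal:
  fixes H :: "complex^'a^'a"
  assumes H: "hermitian H" and eig: "\<And>b. b \<in> B \<Longrightarrow> H *v b = complex_of_real (l b) *s b"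
    and w: "w \<noteq> 0" "\<And>b. b \<in> B \<Longrightarrow> cinner b w = 0"
  obtains v r where "norm v = 1" "\<And>b. b \<in> B \<Longrightarrow> cinner b v = 0"
    "H *v v = complex_of_real r *s v"
proof -
  define W where "W = {w. \<forall>b\<in>B. cinner b w = 0}"
  have subspace: "subspace W"
    by (auto simp: subspace_def W_def cinner_add_right cinner_scaleR_right cinner_zero_right)
  have inv: "H *v u \<in> W" if "u \<in> W" for u
    using that H eig
    by (auto simp: W_def cinner_scale_left simp flip: hermitian_cinner)
  have "W = (\<Inter>b\<in>B. {w. cinner b w = 0})"
    by (auto simp: W_def)
  moreover have "closed {w. cinner b w = 0}" for b
    unfolding cinner_def by (intro closed_Collect_eq continuous_intros)
  ultimately have "closed W"
    by (metis closed_INT)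
  then have "compact (W \<inter> sphere 0 1)"
    by (simp add: closed_Int_compact)
  moreover have "w /\<^sub>R norm w \<in> W \<inter> sphere 0 1"
    using w by (auto simp: W_def cinner_scaleR_right)
  moreover have "continuous_on (W \<inter> sphere 0 1) (\<lambda>v. v \<bullet> (H *v v))"
    by (intro continuous_intros linear_continuous_on matrix_vector_mul_bounded_linear)
  ultimately obtain v where v: "v \<in> W \<inter> sphere 0 1"
    and max: "\<And>u. u \<in> W \<inter> sphere 0 1 \<Longrightarrow> u \<bullet> (H *v u) \<le> v \<bullet> (H *v v)"
    using continuous_attains_sup[of "W \<inter> sphere 0 1" "\<lambda>v. v \<bullet> (H *v v)"] by blast
  define r where "r = v \<bullet> (H *v v)"
  have le: "u \<bullet> (H *v u) \<le> r * (norm u)\<^sup>2" if "u \<in> W" for u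
  proof (cases "u = 0")
    case False
    then have "u /\<^sub>R norm u \<in> W \<inter> sphere 0 1"
      using that subspace by (auto simp: subspace_def)
    from max[OF this] have "(u \<bullet> (H *v u)) / (norm u)\<^sup>2 \<le> r"
      by (simp add: r_def matrix_vector_scaleR power2_eq_square field_simps)
    with False show ?thesis
      by (simp add: field_simps)
  qed auto
  define d where "d = H *v v - r *\<^sub>R v"
  have "d \<in> W"
    unfolding d_def using v inv subspace by (intro subspace_diff) (auto simp: subspace_scale)
  have vv: "v \<bullet> v = 1"
    using v by (simp add: norm_eq_1)
  \<comment> \<open>Maximality at \<open>v\<close>, tested at \<open>v + t *\<^sub>R d\<close>,
    where \<open>d\<close> is the residual of the eigenvalue equation. The first-order gain
    \<open>2 * t * (d \<bullet> d)\<close> would beat the quadratic term for small positive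
    \<open>t\<close> unless \<open>d = 0\<close>.\<close>
  have "2 * t * (d \<bullet> d) \<le> t\<^sup>2 * (r * (d \<bullet> d) - d \<bullet> (H *v d))" for t
  proof -
    have "v + t *\<^sub>R d \<in> W"
      using v \<open>d \<in> W\<close> subspace by (auto simp: subspace_def)
    moreover have "(norm (v + t *\<^sub>R d))\<^sup>2 = 1 + 2 * t * (d \<bullet> v) + t\<^sup>2 * (d \<bullet> d)"
      unfolding power2_norm_eq_inner using vv
      by (simp add: inner_add_left inner_add_right power2_eq_square inner_commute)
    moreover have "(v + t *\<^sub>R d) \<bullet> (H *v (v + t *\<^sub>R d)) =
        r + 2 * t * (d \<bullet> (H *v v)) + t\<^sup>2 * (d \<bullet> (H *v d))"
      using hermitian_inner[OF H, of v d]
      by (simp add: r_def matrix_vector_right_distrib matrix_vector_scaleR inner_add_left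
          inner_add_right power2_eq_square inner_commute distrib_left)
    ultimately have "r + 2 * t * (d \<bullet> (H *v v)) + t\<^sup>2 * (d \<bullet> (H *v d)) \<le>
        r * (1 + 2 * t * (d \<bullet> v) + t\<^sup>2 * (d \<bullet> d))"
      using le[of "v + t *\<^sub>R d"] by simp
    then show ?thesis
      by (simp add: d_def inner_diff_right algebra_simps)
  qed
  have "d \<bullet> d = 0"
  proof (rule ccontr)
    assume "d \<bullet> d \<noteq> 0"
    then have pos: "d \<bullet> d > 0" by simp
    define c where "c = r * (d \<bullet> d) - d \<bullet> (H *v d)"
    have *: "2 * t * (d \<bullet> d) \<le> t\<^sup>2 * c" for t
      using \<open>\<And>t. 2 * t * (d \<bullet> d) \<le> t\<^sup>2 * (r * (d \<bullet> d) - d \<bullet> (H *v d))\<close> by (simp add: c_def)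
    have "2 * (d \<bullet> d) \<le> c" using *[of 1] by simp
    with pos have c: "c > 0" by linarith
    \<comment> \<open>At this \<open>t\<close> the inequality reads
      \<open>2 * a\<^sup>2 / c \<le> a\<^sup>2 / c\<close> with
      \<open>a = d \<bullet> d > 0\<close>.\<close>
    show False
      using *[of "(d \<bullet> d) / c"] mult_pos_pos[OF pos pos] c
      by (simp add: power2_eq_square field_simps)
  qed
  then have "H *v v = complex_of_real r *s v"
    by (simp add: d_def vec_eq_iff scaleR_conv_of_real[where 'a = complex])
  with v show ?thesis
    using that by (auto simp: W_def)
qed

text \<open>For an orthonormal \<open>B\<close> this is the functional calculus: products act
  pointwise on \<open>f\<close>. Eigenvalues are attached to vectors, so repeated ones need no
  bookkeeping; \<open>spectral_sum B (\<lambda>_. 1) = mat 1\<close> expresses completeness of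
  \<open>B\<close>.\<close>

definition spectral_sum :: "(complex^'a) set \<Rightarrow> (complex^'a \<Rightarrow> real) \<Rightarrow> complex^'a^'a" where
  "spectral_sum B f = (\<Sum>b\<in>B. f b *\<^sub>R outer b)"

lemma hermitian_spectral_sum: "hermitian (spectral_sum B f)"
  by (simp add: spectral_sum_def dagger_sum dagger_scaleR hermitian_outer)

text \<open>An orthonormal set of eigenvectors of maximal size is complete, since a nonzero vector
  orthogonal to it would yield a further eigenvector. The maximum exists by
  \<open>orthonormal_card\<close>; the bound there is the real dimension, twice the complex one, but
  any finite bound will do.\<close>

theorem hermitian_spectral:
  fixes H :: "complex^'a^'a"
  assumes H: "hermitian H"
  obtains B f where "orthonormal B" "spectral_sum B (\<lambda>_. 1) = mat 1" "H = spectral_sum B f"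
proof -
  define P where "P B \<longleftrightarrow> orthonormal B \<and> (\<exists>l. \<forall>b\<in>B. H *v b = complex_of_real (l b) *s b)"
    for B
  have "P {}"
    by (simp add: P_def orthonormal_def)
  moreover have "card B < Suc DIM(complex^'a)" if "P B" for B
    using that orthonormal_card by (auto simp: P_def less_Suc_eq_le)
  ultimately obtain B where B: "P B" and maxB: "\<And>C. P C \<Longrightarrow> card C \<le> card B"
    using ex_has_greatest_nat[of P "{}" card] by blast
  obtain l where l: "\<And>b. b \<in> B \<Longrightarrow> H *v b = complex_of_real (l b) *s b"
    using B by (auto simp: P_def)
  have on: "orthonormal B" and fin: "finite B"
    using B by (auto simp: P_def orthonormal_def)
  have triv: "w = 0" if w: "\<And>b. b \<in> B \<Longrightarrow> cinner b w = 0" for w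
  proof (rule ccontr)
    assume "w \<noteq> 0"
    then obtain v r where v: "norm v = 1" "\<And>b. b \<in> B \<Longrightarrow> cinner b v = 0"
      "H *v v = complex_of_real r *s v"
      using hermitian_eigenvector_orthogonal[OF H l _ w] by blast
    have vv: "cinner v v = 1"
      using v by (simp add: cinner_self)
    have "cinner v b = 0" if "b \<in> B" for b
      using v(2)[OF that] cinner_commute[of b v] by simp
    then have "orthonormal (insert v B)"
      using on v vv by (auto simp: orthonormal_def)
    moreover have "\<forall>b\<in>insert v B. H *v b = complex_of_real ((l(v := r)) b) *s b"
      using l v by auto
    ultimately have "P (insert v B)"
      unfolding P_def by blast
    moreover have "v \<notin> B"
      using v vv by fastforce
    ultimately show False
      using maxB[of "insert v B"] fin by simp
  qed
  have one: "spectral_sum B (\<lambda>_. 1) = mat 1"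
    unfolding matrix_eq
  proof
    fix v
    have "cinner c (v - (\<Sum>b\<in>B. cinner b v *s b)) = 0" if "c \<in> B" for c
    proof -
      have "(\<Sum>b\<in>B. cinner b v * cinner c b) = (\<Sum>b\<in>B. if b = c then cinner b v else 0)"
        using on that by (intro sum.cong) (auto simp: orthonormal_def)
      then show ?thesis
        using that fin
        by (simp add: cinner_diff_right cinner_sum_right cinner_scale_right)
    qed
    then have "v - (\<Sum>b\<in>B. cinner b v *s b) = 0"
      by (rule triv)
    then show "spectral_sum B (\<lambda>_. 1) *v v = mat 1 *v v"
      by (simp add: spectral_sum_def matrix_vector_mult_sum_left outer_mult_vec)
  qed
  have "H ** outer b = l b *\<^sub>R outer b" if "b \<in> B" for b
    unfolding matrix_eq
    by (simp add: scaleR_matrix_vector outer_mult_vec l[OF that] vector_scalar_commute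
        flip: matrix_vector_mul_assoc)
       (simp add: vec_eq_iff scaleR_conv_of_real[where 'a = complex])
  then have "H ** spectral_sum B (\<lambda>_. 1) = spectral_sum B l"
    by (simp add: spectral_sum_def matrix_mult_sum_right)
  with one on that show ?thesis
    by simp
qed

lemma outer_mult_outer:
  assumes "orthonormal B" "b \<in> B" "c \<in> B"
  shows "outer b ** outer c = (if b = c then outer b else 0)"
  using assms
  by (auto simp: matrix_eq orthonormal_def outer_mult_vec vector_scalar_commute
      simp flip: matrix_vector_mul_assoc)

lemma spectral_sum_mult:
  assumes "orthonormal B"
  shows "spectral_sum B f ** spectral_sum B g = spectral_sum B (\<lambda>b. f b * g b)"
proof -
  have fin: "finite B"
    using assms by (simp add: orthonormal_def)
  have "spectral_sum B f ** spectral_sum B g =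
      (\<Sum>c\<in>B. \<Sum>b\<in>B. (g c * f b) *\<^sub>R (outer b ** outer c))"
    by (simp add: spectral_sum_def matrix_mult_sum_left matrix_mult_sum_right
        matrix_mult_scaleR_left matrix_mult_scaleR_right scaleR_sum_right)
  also have "\<dots> = (\<Sum>c\<in>B. \<Sum>b\<in>B. if b = c then (f c * g c) *\<^sub>R outer c else 0)"
    by (intro sum.cong refl) (simp add: outer_mult_outer[OF assms])
  also have "\<dots> = spectral_sum B (\<lambda>b. f b * g b)"
    using fin by (simp add: spectral_sum_def)
  finally show ?thesis .
qed

lemma inner_spectral_sum: "v \<bullet> (spectral_sum B f *v v) = (\<Sum>b\<in>B. f b * (cmod (cinner b v))\<^sup>2)"
proof -
  have "cinner v (spectral_sum B f *v v) = (\<Sum>b\<in>B. f b * (cinner b v * cinner v b))"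
    by (simp add: spectral_sum_def matrix_vector_mult_sum_left scaleR_matrix_vector outer_mult_vec
        cinner_sum_right cinner_scaleR_right cinner_scale_right)
  also have "\<dots> = (\<Sum>b\<in>B. of_real (f b * (cmod (cinner b v))\<^sup>2))"
    by (intro sum.cong refl)
       (simp add: complex_norm_square cinner_commute flip: of_real_power)
  finally show ?thesis
    by (simp flip: Re_cinner)
qed

lemma psd_spectral_sum: "(\<And>b. b \<in> B \<Longrightarrow> 0 \<le> f b) \<Longrightarrow> psd (spectral_sum B f)"
  by (simp add: psd_iff hermitian_spectral_sum inner_spectral_sum sum_nonneg)

text \<open>A vector where the nonnegative form vanishes is a minimiser, so the first-order change
  towards \<open>- (M *v v)\<close> must vanish as well; that change is proportional to the squared
  norm of \<open>M *v v\<close>.\<close>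

lemma psd_inner_zero:
  assumes "psd M" "v \<bullet> (M *v v) = 0"
  shows "M *v v = 0"
proof (rule ccontr)
  assume nz: "M *v v \<noteq> 0"
  have H: "hermitian M" and pos: "0 \<le> u \<bullet> (M *v u)" for u
    using assms by (auto simp: psd_iff)
  define w where "w = M *v v"
  define a where "a = w \<bullet> w"
  define c where "c = w \<bullet> (M *v w)"
  have a: "a > 0" using nz by (simp add: a_def w_def)
  have c: "c \<ge> 0" using pos by (simp add: c_def)
  have *: "0 \<le> t\<^sup>2 * c - 2 * t * a" for t
    using pos[of "v - t *\<^sub>R w"] assms(2) hermitian_inner[OF H, of v w]
    by (simp add: matrix_vector_mult_diff_distrib matrix_vector_scaleR inner_diff_left
        inner_diff_right a_def c_def power2_eq_square inner_commute w_def[symmetric] algebra_simps)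
  \<comment> \<open>The \<open>+ 1\<close> keeps the quotient meaningful when \<open>c = 0\<close>
    and still leaves the quadratic term below the linear one.\<close>
  define t where "t = a / (c + 1)"
  have t: "t > 0" "t * (c + 1) = a"
    using a c by (auto simp: t_def)
  have "t\<^sup>2 * c \<le> t * (t * (c + 1))"
    by (simp add: power2_eq_square algebra_simps)
  also have "\<dots> < 2 * t * a"
    using t a by simp
  finally show False using *[of t] by simp
qed

lemma spectral_sum_eigenvector:
  assumes "orthonormal B" "b \<in> B"
  shows "spectral_sum B f *v b = f b *\<^sub>R b"
proof -
  have "spectral_sum B f *v b = (\<Sum>c\<in>B. if c = b then f b *\<^sub>R b else 0)"
    unfolding spectral_sum_def matrix_vector_mult_sum_left
    using assms
    by (intro sum.cong refl) (auto simp: scaleR_matrix_vector outer_mult_vec orthonormal_def)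
  then show ?thesis
    using assms by (simp add: orthonormal_def)
qed

section \<open>Trace norm and guessing probability\<close>

text \<open>Uniqueness gives the definite description \<open>matrix_sqrt\<close> its value. With
  \<open>D = R - S\<close>, equal squares give \<open>D (R + S) + (R + S) D = 0\<close>. On an
  eigenvector of \<open>D\<close> with nonzero eigenvalue this forces the nonnegative forms of
  \<open>R\<close> and \<open>S\<close> to vanish; then both matrices kill the vector, and so does
  \<open>D\<close>.\<close>

lemma psd_sqrt_unique:
  fixes R S :: "complex^'a^'a"
  assumes R: "psd R" and S: "psd S" and eq: "R ** R = S ** S"
  shows "R = S"
proof -
  have "hermitian (R - S)"
    using R S by (simp add: psd_iff dagger_diff)
  then obtain B f where B: "orthonormal B" "R - S = spectral_sum B f"
    using hermitian_spectral by metis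
  have anti: "(R - S) ** (R + S) + (R + S) ** (R - S) = 0"
    using eq by (simp add: matrix_add_ldistrib matrix_mult_diff_left matrix_mult_diff_right
        matrix_mult_add_left)
  have "f b = 0" if b: "b \<in> B" for b
  proof (rule ccontr)
    assume "f b \<noteq> 0"
    have D: "(R - S) *v b = f b *\<^sub>R b"
      using B b by (simp add: spectral_sum_eigenvector)
    have "0 = b \<bullet> (((R - S) ** (R + S) + (R + S) ** (R - S)) *v b)"
      by (simp add: anti)
    also have "\<dots> = 2 * f b * (b \<bullet> ((R + S) *v b))"
      using hermitian_inner[OF \<open>hermitian (R - S)\<close>, of b "(R + S) *v b"] D
      by (simp add: matrix_vector_mult_add_rdistrib inner_add_right matrix_vector_scaleR
          distrib_left flip: matrix_vector_mul_assoc)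
    finally have "b \<bullet> (R *v b) + b \<bullet> (S *v b) = 0"
      using \<open>f b \<noteq> 0\<close> by (simp add: matrix_vector_mult_add_rdistrib inner_add_right)
    then have "b \<bullet> (R *v b) = 0" "b \<bullet> (S *v b) = 0"
      using R S by (auto simp: psd_iff add_nonneg_eq_0_iff)
    then have "(R - S) *v b = 0"
      using R S by (simp add: psd_inner_zero matrix_vector_mult_diff_rdistrib)
    then have "b = 0"
      using D \<open>f b \<noteq> 0\<close> by simp
    then show False
      using B(1) b by (auto simp: orthonormal_def cinner_zero_right dest!: bspec[of _ _ 0])
  qed
  then have "R - S = 0"
    using B by (simp add: spectral_sum_def)
  then show ?thesis by simp
qed

lemma matrix_sqrt_eqI: "psd R \<Longrightarrow> R ** R = M \<Longrightarrow> matrix_sqrt M = R"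
  unfolding matrix_sqrt_def by (rule the_equality) (auto intro: psd_sqrt_unique)

definition contraction :: "complex^'a^'a \<Rightarrow> bool" where
  "contraction T \<longleftrightarrow> (\<forall>v. norm (T *v v) \<le> norm v)"

text \<open>\<open>T\<close> is the sign of \<open>H\<close>, so that \<open>T ** H\<close> is the
  absolute value of \<open>H\<close>.\<close>

lemma trace_norm_hermitian:
  fixes H :: "complex^'a^'a"
  assumes "hermitian H"
  obtains T where "hermitian T" "contraction T" "trace_norm H = 1/2 * Re (trace (T ** H))"
proof -
  obtain B f where B: "orthonormal B" "spectral_sum B (\<lambda>_. 1) = mat 1" "H = spectral_sum B f"
    using hermitian_spectral[OF assms] by blast
  \<comment> \<open>The value 1 at eigenvalue 0 makes \<open>T ** T = mat 1\<close> hold exactly,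
    and hence \<open>T\<close> an isometry.\<close>
  define T where "T = spectral_sum B (\<lambda>b. if f b < 0 then -1 else 1)"
  have herm: "hermitian T"
    by (simp add: T_def hermitian_spectral_sum)
  have "T ** T = mat 1"
    unfolding T_def spectral_sum_mult[OF B(1)] B(2)[symmetric]
    by (intro arg_cong[where f = "spectral_sum B"] ext) auto
  have "norm (T *v v) = norm v" for v
  proof -
    have "(T *v v) \<bullet> (T *v v) = v \<bullet> ((T ** T) *v v)"
      using hermitian_inner[OF herm, of v "T *v v"] by (simp add: matrix_vector_mul_assoc)
    then show ?thesis
      by (simp add: \<open>T ** T = mat 1\<close> norm_eq_sqrt_inner)
  qed
  then have "contraction T"
    by (simp add: contraction_def)
  have "matrix_sqrt (dagger H ** H) = spectral_sum B (\<lambda>b. \<bar>f b\<bar>)"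
    unfolding assms by (rule matrix_sqrt_eqI) (auto simp: psd_spectral_sum B spectral_sum_mult)
  moreover have "T ** H = spectral_sum B (\<lambda>b. \<bar>f b\<bar>)"
    unfolding T_def B(3) spectral_sum_mult[OF B(1)]
    by (intro arg_cong[where f = "spectral_sum B"] ext) auto
  ultimately show ?thesis
    using that herm \<open>contraction T\<close> by (simp add: trace_norm_def)
qed

lemma psd_trace_mult_nonneg:
  fixes M N :: "complex^'a^'a"
  assumes M: "psd M" and N: "psd N"
  shows "0 \<le> Re (trace (M ** N))"
proof -
  obtain B f where B: "orthonormal B" "N = spectral_sum B f"
    using hermitian_spectral psd_imp_hermitian[OF N] by metis
  have "0 \<le> f b" if "b \<in> B" for b
  proof -
    have "b \<bullet> b = 1"
      using B(1) that by (simp add: orthonormal_def flip: Re_cinner)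
    then have "b \<bullet> (N *v b) = f b"
      using spectral_sum_eigenvector[OF B(1) that] B(2) by simp
    then show ?thesis
      using N by (metis psd_iff)
  qed
  moreover have "Re (trace (M ** N)) = (\<Sum>b\<in>B. f b * (b \<bullet> (M *v b)))"
    by (simp add: B(2) spectral_sum_def matrix_mult_sum_right matrix_mult_scaleR_right trace_sum
        trace_scaleR trace_mult_outer Re_cinner)
  ultimately show ?thesis
    using M by (simp add: psd_iff sum_nonneg)
qed

lemma psd_add: "psd M \<Longrightarrow> psd N \<Longrightarrow> psd (M + N)"
  by (simp add: psd_iff dagger_add matrix_vector_mult_add_rdistrib inner_add_right)

lemma psd_zero: "psd 0" and psd_mat_1: "psd (mat 1)"
  by (simp_all add: psd_iff)

lemma psd_sum: "(\<And>k. k \<in> K \<Longrightarrow> psd (f k)) \<Longrightarrow> psd (\<Sum>k\<in>K. f k)"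
  by (induction K rule: infinite_finite_induct) (simp_all add: psd_add psd_zero)

lemma inner_hermitian_square:
  "hermitian F \<Longrightarrow> v \<bullet> ((F ** F) *v v) = (norm (F *v v))\<^sup>2"
  by (metis hermitian_inner matrix_vector_mul_assoc power2_norm_eq_inner)

lemma psd_hermitian_square: "hermitian F \<Longrightarrow> psd (F ** F)"
  by (simp add: psd_iff dagger_mult inner_hermitian_square)

lemma psd_scaleR: "psd M \<Longrightarrow> 0 \<le> r \<Longrightarrow> psd (r *\<^sub>R M)"
  by (simp add: psd_iff dagger_scaleR scaleR_matrix_vector)

section \<open>Guessing probability\<close>

lemma expectation_finite: "measure_pmf.expectation X f = (\<Sum>x\<in>UNIV. pmf X x * f x)"
  for X :: "'x::finite pmf" and f :: "'x \<Rightarrow> real"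
  by (subst integral_measure_pmf[of UNIV]) auto

lemma sum_pmf_finite: "(\<Sum>x\<in>UNIV. pmf X x) = 1" for X :: "'x::finite pmf"
  by (rule sum_pmf_eq_1) auto

text \<open>What the \<open>N y\<close> leave of the identity is positive semidefinite by
  \<open>sub\<close>. Adding it to one outcome completes them to a POVM and can only increase the
  guessing probability.\<close>

lemma sub_POVM_guess:
  fixes Y :: "'y::finite pmf" and \<rho> N :: "'y \<Rightarrow> complex^'b^'b"
  assumes \<rho>: "\<And>y. density_matrix (\<rho> y)" and k: "guessing_entropy Y \<rho> \<ge> k"
    and N: "\<And>y. psd (N y)" and sub: "\<And>v. (\<Sum>y\<in>UNIV. v \<bullet> (N y *v v)) \<le> (norm v)\<^sup>2"
  shows "(\<Sum>y\<in>UNIV. pmf Y y * Re (trace (N y ** \<rho> y))) \<le> 2 powr - k"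
proof -
  let ?g = "\<lambda>M. measure_pmf.expectation Y (\<lambda>y. Re (trace (M y ** \<rho> y)))"
  have psd_\<rho>: "psd (\<rho> y)" and tr_\<rho>: "trace (\<rho> y) = 1" for y
    using \<rho> by (auto simp: density_matrix_def)
  define C where "C = mat 1 - (\<Sum>y\<in>UNIV. N y)"
  have C: "psd C"
    using N sub
    by (auto simp: C_def psd_iff dagger_diff dagger_sum matrix_vector_mult_diff_rdistrib
        inner_diff_right matrix_vector_mult_sum_left inner_sum_right power2_norm_eq_inner)
  \<comment> \<open>\<open>undefined\<close> serves as an arbitrary but fixed outcome that receives
    the remainder.\<close>
  define M where "M y = N y + (if y = undefined then C else 0)" for y
  have "POVM M"
    using N C by (simp add: POVM_def M_def psd_add sum.distrib C_def)
  have "?g M' \<le> 1" if "POVM M'" for M'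
  proof -
    have "Re (trace (M' y ** \<rho> y)) \<le> 1" for y
    proof -
      have "mat 1 - M' y = (\<Sum>z\<in>UNIV - {y}. M' z)"
        using that sum.remove[of UNIV y M'] by (simp add: POVM_def diff_eq_eq add.commute)
      then have "psd (mat 1 - M' y)"
        using that by (simp add: POVM_def psd_sum)
      from psd_trace_mult_nonneg[OF this psd_\<rho>[of y]] show ?thesis
        by (simp add: matrix_mult_diff_left trace_sub tr_\<rho>)
    qed
    then have "(\<Sum>y\<in>UNIV. pmf Y y * Re (trace (M' y ** \<rho> y))) \<le> (\<Sum>y\<in>UNIV. pmf Y y * 1)"
      by (intro sum_mono mult_left_mono) auto
    then show ?thesis
      by (simp add: expectation_finite sum_pmf_finite)
  qed
  then have "?g M \<le> (SUP M\<in>{M. POVM M}. ?g M)"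
    using \<open>POVM M\<close> by (intro cSUP_upper) (auto intro!: bdd_aboveI)
  also have "\<dots> \<le> 2 powr - k"
  \<comment> \<open>\<open>log_le_iff\<close> needs a positive argument; a nonpositive supremum is
    below the power anyway.\<close>
  proof (cases "(SUP M\<in>{M. POVM M}. ?g M) > 0")
    case True
    have "log 2 (SUP M\<in>{M. POVM M}. ?g M) \<le> - k"
      using k by (simp add: guessing_entropy_def)
    with True show ?thesis
      by (simp add: log_le_iff)
  next
    case False
    then show ?thesis
      by (meson powr_ge_zero linorder_not_less order_trans)
  qed
  finally have "?g M \<le> 2 powr - k" .
  moreover have "Re (trace (N y ** \<rho> y)) \<le> Re (trace (M y ** \<rho> y))" for y
    using psd_trace_mult_nonneg[OF C psd_\<rho>[of y]]
    by (auto simp: M_def matrix_mult_add_left trace_add trace_def[of 0])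
  then have "(\<Sum>y\<in>UNIV. pmf Y y * Re (trace (N y ** \<rho> y))) \<le> ?g M"
    unfolding expectation_finite by (intro sum_mono mult_left_mono) auto
  ultimately show ?thesis
    by linarith
qed

text \<open>The strategy that ignores the quantum system and always answers \<open>x\<close>
  succeeds with probability \<open>pmf X x\<close>. This is how the entropy of the revealed source
  enters the proof.\<close>

lemma pmf_le_guessing_entropy:
  fixes X :: "'x::finite pmf" and \<rho> :: "'x \<Rightarrow> complex^'b^'b"
  assumes \<rho>: "\<And>x. density_matrix (\<rho> x)" and k: "guessing_entropy X \<rho> \<ge> k"
  shows "pmf X x \<le> 2 powr - k"
proof -
  have "(\<Sum>z\<in>UNIV. pmf X z * Re (trace ((if z = x then mat 1 else 0) ** \<rho> z))) \<le> 2 powr - k"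
    using assms
    by (intro sub_POVM_guess[OF \<rho> k])
       (auto simp: psd_zero psd_mat_1 power2_norm_eq_inner if_distrib[of "\<lambda>M. M *v _"]
         if_distrib[of "\<lambda>u. _ \<bullet> u"] cong: if_cong)
  also have "(\<Sum>z\<in>UNIV. pmf X z * Re (trace ((if z = x then mat 1 else 0) ** \<rho> z))) =
      (\<Sum>z\<in>UNIV. if z = x then pmf X x else 0)"
    using \<rho> by (intro sum.cong refl) (auto simp: density_matrix_def trace_def[of 0])
  finally show ?thesis by simp
qed

section \<open>Correlation of a sign matrix with quantum side information\<close>

lemma hermitian_sum_scaleR:
  "(\<And>k. k \<in> K \<Longrightarrow> hermitian (T k)) \<Longrightarrow> hermitian (\<Sum>k\<in>K. c k *\<^sub>R T k)"
  by (simp add: dagger_sum dagger_scaleR)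

lemma contraction_sum_scaleR:
  fixes T :: "'k \<Rightarrow> complex^'a^'a"
  assumes T: "\<And>k. k \<in> K \<Longrightarrow> contraction (T k)" and c: "(\<Sum>k\<in>K. \<bar>c k\<bar>) \<le> 1"
  shows "contraction (\<Sum>k\<in>K. c k *\<^sub>R T k)"
  unfolding contraction_def
proof
  fix v
  have "norm ((\<Sum>k\<in>K. c k *\<^sub>R T k) *v v) \<le> (\<Sum>k\<in>K. \<bar>c k\<bar> * norm (T k *v v))"
    unfolding matrix_vector_mult_sum_left scaleR_matrix_vector
    by (rule order_trans[OF norm_sum]) simp
  also have "\<dots> \<le> (\<Sum>k\<in>K. \<bar>c k\<bar> * norm v)"
    using T by (intro sum_mono mult_left_mono) (auto simp: contraction_def)
  also have "\<dots> \<le> norm v"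
    using c mult_right_mono[of "\<Sum>k\<in>K. \<bar>c k\<bar>" 1 "norm v"] by (simp add: sum_distrib_right)
  finally show "norm ((\<Sum>k\<in>K. c k *\<^sub>R T k) *v v) \<le> norm v" .
qed

text \<open>Expand the square and sum over \<open>y\<close> first: distinct rows of \<open>w\<close>
  cancel, and each row has squared length \<open>CARD('y)\<close>.\<close>

lemma parseval:
  fixes w :: "'x::finite \<Rightarrow> 'y::finite \<Rightarrow> real" and u :: "'x \<Rightarrow> 'v::real_inner"
  assumes w: "\<And>x y. (w x y)\<^sup>2 = 1" and orth: "\<And>x x'. x \<noteq> x' \<Longrightarrow> (\<Sum>y\<in>UNIV. w x y * w x' y) = 0"
  shows "(\<Sum>y\<in>UNIV. (norm (\<Sum>x\<in>UNIV. w x y *\<^sub>R u x))\<^sup>2) = CARD('y) * (\<Sum>x\<in>UNIV. (norm (u x))\<^sup>2)"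
proof -
  have "(\<Sum>y\<in>UNIV. (norm (\<Sum>x\<in>UNIV. w x y *\<^sub>R u x))\<^sup>2) =
      (\<Sum>y\<in>UNIV. \<Sum>x\<in>UNIV. \<Sum>x'\<in>UNIV. (w x y * w x' y) * (u x \<bullet> u x'))"
    by (simp add: power2_norm_eq_inner inner_sum_left inner_sum_right sum_distrib_left mult_ac
        inner_commute)
  also have "\<dots> = (\<Sum>x\<in>UNIV. \<Sum>x'\<in>UNIV. (\<Sum>y\<in>UNIV. w x y * w x' y) * (u x \<bullet> u x'))"
    by (subst sum.swap, intro sum.cong refl, subst sum.swap) (simp add: sum_distrib_right)
  also have "\<dots> = (\<Sum>x\<in>UNIV. \<Sum>x'\<in>UNIV. if x' = x then CARD('y) * (norm (u x))\<^sup>2 else 0)"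
    by (intro sum.cong refl) (auto simp: w[unfolded power2_eq_square] orth power2_norm_eq_inner)
  finally show ?thesis
    by (simp add: sum_distrib_left)
qed

text \<open>The arguments of \<open>min\<close> are two bounds on the second moment
  \<open>G\<close>, which dominates the square of the left-hand side \<open>L\<close>: one comes
  from \<open>F y\<close> being a contraction, the other from guessing \<open>Y\<close>.\<close>

lemma correlation_bound:
  fixes X :: "'x::finite pmf" and Y :: "'y::finite pmf" and \<rho> :: "'y \<Rightarrow> complex^'b^'b"
    and w :: "'x \<Rightarrow> 'y \<Rightarrow> real" and T :: "'x \<Rightarrow> complex^'b^'b"
  assumes w: "\<And>x y. (w x y)\<^sup>2 = 1" and orth: "\<And>x x'. x \<noteq> x' \<Longrightarrow> (\<Sum>y\<in>UNIV. w x y * w x' y) = 0"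
    and T: "\<And>x. hermitian (T x)" "\<And>x. contraction (T x)"
    and X: "\<And>x. pmf X x \<le> 2 powr - k1"
    and \<rho>: "\<And>y. density_matrix (\<rho> y)" and Y: "guessing_entropy Y \<rho> \<ge> k2"
  shows "(\<Sum>x\<in>UNIV. \<Sum>y\<in>UNIV. pmf X x * pmf Y y * w x y * Re (trace (T x ** \<rho> y)))
    \<le> sqrt (min 1 (CARD('y) * 2 powr - (k1 + k2)))"
proof -
  have psd_\<rho>: "psd (\<rho> y)" and tr_\<rho>: "trace (\<rho> y) = 1" for y
    using \<rho> by (auto simp: density_matrix_def)
  define F where "F y = (\<Sum>x\<in>UNIV. (pmf X x * w x y) *\<^sub>R T x)" for y
  define L where "L = (\<Sum>y\<in>UNIV. pmf Y y * Re (trace (F y ** \<rho> y)))"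
  define G where "G = (\<Sum>y\<in>UNIV. pmf Y y * Re (trace ((F y ** F y) ** \<rho> y)))"
  have "\<bar>w x y\<bar> = 1" for x y
    using w[of x y] by (simp add: power2_eq_1_iff) auto
  then have contr: "contraction (F y)" for y
    unfolding F_def using T
    by (intro contraction_sum_scaleR) (auto simp: abs_mult sum_pmf_finite)
  have herm: "hermitian (F y)" for y
    unfolding F_def using T by (intro hermitian_sum_scaleR) auto
  \<comment> \<open>Positivity of the square of \<open>F y - L *\<^sub>R mat 1\<close>; averaged
    over \<open>y\<close> it says that a variance is nonnegative, that is
    \<open>L\<^sup>2 \<le> G\<close>.\<close>
  have sq: "0 \<le> Re (trace ((F y ** F y) ** \<rho> y)) - 2 * L * Re (trace (F y ** \<rho> y)) + L\<^sup>2" for y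
  proof -
    let ?D = "F y - L *\<^sub>R mat 1"
    have "psd (?D ** ?D)"
      using herm by (intro psd_hermitian_square) (simp add: dagger_diff dagger_scaleR)
    moreover have "(2 * L) *\<^sub>R F y = L *\<^sub>R F y + L *\<^sub>R F y"
      by (metis mult_2 scaleR_add_left)
    then have "?D ** ?D = F y ** F y - (2 * L) *\<^sub>R F y + L\<^sup>2 *\<^sub>R mat 1"
      by (simp add: matrix_mult_diff_left matrix_mult_diff_right matrix_mult_scaleR_left
          matrix_mult_scaleR_right power2_eq_square scaleR_diff_right)
    ultimately show ?thesis
      using psd_trace_mult_nonneg[of "?D ** ?D" "\<rho> y"] psd_\<rho>[of y] tr_\<rho>[of y]
      by (simp add: matrix_mult_diff_left matrix_mult_add_left matrix_mult_scaleR_left trace_add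
          trace_sub trace_scaleR)
  qed
  have "0 \<le> (\<Sum>y\<in>UNIV. pmf Y y *
      (Re (trace ((F y ** F y) ** \<rho> y)) - 2 * L * Re (trace (F y ** \<rho> y)) + L\<^sup>2))"
    using sq by (intro sum_nonneg mult_nonneg_nonneg) auto
  \<comment> \<open>A free \<open>l\<close> stands for the multiplier, which is \<open>L\<close> in
    the chain, so that unfolding \<open>L_def\<close> affects only the sum that arises.\<close>
  also have "(\<Sum>y\<in>UNIV. pmf Y y * (Re (trace ((F y ** F y) ** \<rho> y)) -
      2 * l * Re (trace (F y ** \<rho> y)) + l\<^sup>2)) = G - 2 * l * L + l\<^sup>2" for l
  proof -
    have "(\<Sum>y\<in>UNIV. pmf Y y * (Re (trace ((F y ** F y) ** \<rho> y)) -
        2 * l * Re (trace (F y ** \<rho> y)) + l\<^sup>2)) = G - 2 * l * L + (\<Sum>y\<in>UNIV. pmf Y y) * l\<^sup>2"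
      by (simp add: G_def L_def distrib_left right_diff_distrib sum.distrib sum_subtractf
          sum_distrib_left sum_distrib_right mult_ac)
    then show ?thesis
      by (simp add: sum_pmf_finite)
  qed
  finally have LG: "L\<^sup>2 \<le> G"
    by (simp add: power2_eq_square)
  have "Re (trace ((F y ** F y) ** \<rho> y)) \<le> 1" for y
  proof -
    have "psd (mat 1 - F y ** F y)"
      using contr herm
      by (simp add: psd_iff dagger_diff dagger_mult matrix_vector_mult_diff_rdistrib
          inner_diff_right inner_hermitian_square contraction_def flip: power2_norm_eq_inner)
    from psd_trace_mult_nonneg[OF this psd_\<rho>[of y]] show ?thesis
      by (simp add: matrix_mult_diff_left trace_sub tr_\<rho>)
  qed
  then have "G \<le> (\<Sum>y\<in>UNIV. pmf Y y * 1)"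
    unfolding G_def by (intro sum_mono mult_left_mono) auto
  then have G1: "G \<le> 1"
    by (simp add: sum_pmf_finite)
  \<comment> \<open>The scale at which the \<open>F y ** F y\<close> become a sub-POVM: Parseval
    contributes \<open>CARD('y)\<close>, one factor \<open>pmf X x\<close> is at most
    \<open>2 powr - k1\<close>, and the other sums to 1.\<close>
  define c where "c = CARD('y) * 2 powr - k1"
  have c: "c > 0"
    by (simp add: c_def)
  have sub: "(\<Sum>y\<in>UNIV. v \<bullet> (((1/c) *\<^sub>R (F y ** F y)) *v v)) \<le> (norm v)\<^sup>2" for v
  proof -
    have "(\<Sum>y\<in>UNIV. v \<bullet> ((F y ** F y) *v v)) =
        (\<Sum>y\<in>UNIV. (norm (\<Sum>x\<in>UNIV. w x y *\<^sub>R (pmf X x *\<^sub>R (T x *v v))))\<^sup>2)"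
      by (simp add: inner_hermitian_square[OF herm])
         (simp add: F_def matrix_vector_mult_sum_left scaleR_matrix_vector mult.commute)
    also have "\<dots> = CARD('y) * (\<Sum>x\<in>UNIV. (norm (pmf X x *\<^sub>R (T x *v v)))\<^sup>2)"
      by (rule parseval[OF w orth])
    also have "\<dots> \<le> CARD('y) * (\<Sum>x\<in>UNIV. pmf X x * (2 powr - k1 * (norm v)\<^sup>2))"
    proof (intro mult_left_mono sum_mono)
      fix x
      have "(norm (pmf X x *\<^sub>R (T x *v v)))\<^sup>2 = pmf X x * (pmf X x * (norm (T x *v v))\<^sup>2)"
        by (simp add: power2_eq_square)
      also have "\<dots> \<le> pmf X x * (2 powr - k1 * (norm v)\<^sup>2)"
        using X[of x] T(2)[of x]
        by (intro mult_left_mono mult_mono power_mono) (auto simp: contraction_def)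
      finally show "(norm (pmf X x *\<^sub>R (T x *v v)))\<^sup>2 \<le> pmf X x * (2 powr - k1 * (norm v)\<^sup>2)" .
    qed simp
    also have "\<dots> = c * (norm v)\<^sup>2"
      by (simp add: c_def sum_pmf_finite flip: sum_distrib_right)
    finally show ?thesis
      using c by (simp add: scaleR_matrix_vector field_simps flip: sum_divide_distrib)
  qed
  have "(\<Sum>y\<in>UNIV. pmf Y y * Re (trace (((1/c) *\<^sub>R (F y ** F y)) ** \<rho> y))) \<le> 2 powr - k2"
    using c herm
    by (intro sub_POVM_guess[OF \<rho> Y _ sub] psd_scaleR psd_hermitian_square) auto
  then have "G / c \<le> 2 powr - k2"
    by (simp add: G_def matrix_mult_scaleR_left trace_scaleR sum_divide_distrib)
  then have "G \<le> CARD('y) * 2 powr - (k1 + k2)"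
    using c by (simp add: field_simps c_def powr_diff powr_minus powr_add)
  with LG G1 have "L\<^sup>2 \<le> min 1 (CARD('y) * 2 powr - (k1 + k2))"
    by simp
  then have "L \<le> sqrt (min 1 (CARD('y) * 2 powr - (k1 + k2)))"
    by (rule real_le_rsqrt)
  moreover have "L = (\<Sum>y\<in>UNIV. \<Sum>x\<in>UNIV. pmf X x * pmf Y y * w x y * Re (trace (T x ** \<rho> y)))"
    by (simp add: L_def F_def matrix_mult_sum_left matrix_mult_scaleR_left trace_sum trace_scaleR
        sum_distrib_left mult_ac)
  ultimately show ?thesis
    by (subst sum.swap) simp
qed

section \<open>Diagonal blocks of an operator on three registers\<close>

text \<open>The compression of \<open>T\<close> to the basis states \<open>z\<close> and
  \<open>x\<close> of the outer registers; it acts on the side information alone.\<close>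

definition diagonal_block ::
  "'z::finite \<Rightarrow> 'x::finite \<Rightarrow> complex^('z \<times> 'b::finite \<times> 'x)^('z \<times> 'b \<times> 'x) \<Rightarrow> complex^'b^'b" where
  "diagonal_block z x T = (\<chi> i j. T $ (z, i, x) $ (z, j, x))"

lemma sum_slice:
  fixes f :: "'z::finite \<times> 'b::finite \<times> 'x::finite \<Rightarrow> 'c::comm_monoid_add"
  assumes "\<And>z' a x'. z' \<noteq> z \<or> x' \<noteq> x \<Longrightarrow> f (z', a, x') = 0"
  shows "sum f UNIV = (\<Sum>a\<in>UNIV. f (z, a, x))"
proof -
  have "sum f UNIV = sum f (range (\<lambda>a. (z, a, x)))"
    using assms by (intro sum.mono_neutral_right) (auto simp: image_iff)
  also have "\<dots> = (\<Sum>a\<in>UNIV. f (z, a, x))"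
    by (subst sum.reindex) (auto simp: inj_on_def)
  finally show ?thesis .
qed

lemma hermitian_diagonal_block: "hermitian T \<Longrightarrow> hermitian (diagonal_block z x T)"
  by (simp add: dagger_def diagonal_block_def vec_eq_iff)

text \<open>\<open>u\<close> embeds \<open>v\<close> isometrically in the slice given by
  \<open>z\<close> and \<open>x\<close>. The block returns the coordinates of \<open>T *v u\<close>
  in that slice, and discarding the others does not increase the norm.\<close>

lemma contraction_diagonal_block:
  fixes T :: "complex^('z::finite \<times> 'b::finite \<times> 'x::finite)^('z \<times> 'b \<times> 'x)"
  assumes "contraction T"
  shows "contraction (diagonal_block z x T)"
  unfolding contraction_def
proof
  fix v :: "complex^'b"
  define u where "u = (\<chi> i. if fst i = z \<and> snd (snd i) = x then v $ fst (snd i) else 0)"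
  have norm: "(norm t)\<^sup>2 = (\<Sum>i\<in>UNIV. (cmod (t $ i))\<^sup>2)" for t :: "complex^'k"
    by (simp add: norm_vec_def L2_set_def sum_nonneg)
  have "(norm (diagonal_block z x T *v v))\<^sup>2 = (\<Sum>a\<in>UNIV. (cmod ((T *v u) $ (z, a, x)))\<^sup>2)"
    unfolding norm
    by (simp add: matrix_vector_mult_def diagonal_block_def)
       (subst sum_slice[of z x], auto simp: u_def)
  also have "\<dots> = (\<Sum>i\<in>range (\<lambda>a. (z, a, x)). (cmod ((T *v u) $ i))\<^sup>2)"
    by (subst sum.reindex) (auto simp: inj_on_def)
  also have "\<dots> \<le> (norm (T *v u))\<^sup>2"
    unfolding norm by (intro sum_mono2) auto
  also have "\<dots> \<le> (norm u)\<^sup>2"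
    using assms by (simp add: contraction_def)
  also have "\<dots> = (norm v)\<^sup>2"
    unfolding norm by (subst sum_slice[of z x]) (auto simp: u_def)
  finally show "norm (diagonal_block z x T *v v) \<le> norm v"
    by simp
qed

lemma trace_mult_block:
  fixes T :: "complex^('z::finite \<times> 'b::finite \<times> 'x::finite)^('z \<times> 'b \<times> 'x)"
  shows "trace (T ** (ketbra z \<otimes> \<rho> \<otimes> ketbra x)) = trace (diagonal_block z x T ** \<rho>)"
proof -
  have "trace (T ** (ketbra z \<otimes> \<rho> \<otimes> ketbra x)) =
      (\<Sum>i\<in>UNIV. \<Sum>j\<in>UNIV. T $ i $ j * (ketbra z \<otimes> \<rho> \<otimes> ketbra x) $ j $ i)"
    by (simp add: trace_def matrix_matrix_mult_def)
  also have "\<dots> = (\<Sum>a\<in>UNIV. \<Sum>j\<in>UNIV. T $ (z, a, x) $ j * (ketbra z \<otimes> \<rho> \<otimes> ketbra x) $ j $ (z, a, x))"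
    by (rule sum_slice) (auto simp: tensor_def ketbra_def intro!: sum.neutral)
  also have "\<dots> = (\<Sum>a\<in>UNIV. \<Sum>b\<in>UNIV. T $ (z, a, x) $ (z, b, x) * \<rho> $ b $ a)"
    by (intro sum.cong refl, subst sum_slice[of z x]) (auto simp: tensor_def ketbra_def)
  finally show ?thesis
    by (simp add: trace_def matrix_matrix_mult_def diagonal_block_def)
qed

section \<open>Characters of bit vectors\<close>

text \<open>By default the simplifier turns \<open>+\<close> and \<open>*\<close> on \<open>bit\<close> into XOR and AND, which blocks
  ring normalisation.\<close>

declare add_bit_eq_xor [simp del] mult_bit_eq_and [simp del]

text \<open>The nontrivial additive character of \<open>GF(2)\<close>, with real values.\<close>

definition bit_sign :: "bit \<Rightarrow> real" where
  "bit_sign b = (if b = 0 then 1 else -1)"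

lemma bit_sign_add: "bit_sign (a + b) = bit_sign a * bit_sign b"
  by (cases a; cases b) (simp_all add: bit_sign_def add_bit_eq_xor)

lemma bit_sign_sum: "bit_sign (\<Sum>i\<in>S. f i) = (\<Prod>i\<in>S. bit_sign (f i))"
  by (induction S rule: infinite_finite_induct) (simp_all add: bit_sign_add bit_sign_def[of 0])

definition character :: "'m set \<Rightarrow> bit^'m \<Rightarrow> real" where
  "character S e = (\<Prod>i\<in>S. bit_sign (e $ i))"

lemma character_sum: "character S e = bit_sign (\<Sum>i\<in>S. e $ i)"
  by (simp add: character_def bit_sign_sum)

lemma character_square: "(character S e)\<^sup>2 = 1" and abs_character: "\<bar>character S e\<bar> = 1"
  by (simp_all add: character_sum bit_sign_def)

lemma card_bit [simp]: "CARD(bit) = 2"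
proof -
  have "(UNIV :: bit set) = {0, 1}"
    using bit.exhaust by auto
  then show ?thesis
    by (metis card_2_iff zero_neq_one)
qed

text \<open>The sum over subsets is the expanded product over \<open>i\<close> of
  \<open>bit_sign (e $ i) * bit_sign (z $ i) + 1\<close>, whose factors are 2 where the vectors
  agree and 0 elsewhere.\<close>

lemma character_completeness:
  "(\<Sum>S\<in>UNIV. character S e * character S z) = (if e = z then 2 ^ CARD('m) else 0)" for e z :: "bit^'m"
proof -
  have "(\<Sum>S\<in>UNIV. character S e * character S z) =
      (\<Sum>S\<in>Pow UNIV. (\<Prod>i\<in>S. bit_sign (e $ i) * bit_sign (z $ i)) * (\<Prod>i\<in>UNIV - S. 1))"
    by (simp add: character_def prod.distrib)
  also have "\<dots> = (\<Prod>i\<in>UNIV. bit_sign (e $ i) * bit_sign (z $ i) + 1)"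
    by (subst prod_add) auto
  also have "\<dots> = (\<Prod>i\<in>UNIV. if e $ i = z $ i then 2 else 0)"
    by (intro prod.cong refl) (auto simp: bit_sign_def)
  also have "\<dots> = (if e = z then 2 ^ CARD('m) else 0)"
    by (auto simp: vec_eq_iff intro!: prod_zero)
  finally show ?thesis .
qed

text \<open>The trivial character contributes exactly the uniform weight, so subtracting that weight
  removes \<open>S = {}\<close> from the expansion.\<close>

lemma indicator_minus_uniform:
  "of_bool (e = z) - 1 / 2 ^ CARD('m) = (\<Sum>S\<in>UNIV - {{}}. character S e * character S z) / 2 ^ CARD('m)"
  for e z :: "bit^'m"
proof -
  have "(\<Sum>S\<in>UNIV. character S e * character S z) = character {} e * character {} z + (\<Sum>S\<in>UNIV - {{}}. character S e * character S z)"
    by (rule sum.remove) auto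
  then have "(\<Sum>S\<in>UNIV - {{}}. character S e * character S z) = (if e = z then 2 ^ CARD('m) else 0) - 1"
    by (simp add: character_completeness) (simp add: character_def)
  then show ?thesis
    by (simp add: diff_divide_distrib)
qed

section \<open>Distance from uniform\<close>

text \<open>The first source is the revealed one, and the sources may have different types;
  exchanging their roles also covers the Y-strong case.\<close>

definition uniformity_defect ::
  "('x::finite \<Rightarrow> 'y::finite \<Rightarrow> bit^'m) \<Rightarrow> 'x pmf \<Rightarrow> 'y pmf \<Rightarrow> ('y \<Rightarrow> complex^'b^'b) \<Rightarrow>
    complex^((bit^'m) \<times> 'b \<times> 'x)^((bit^'m) \<times> 'b \<times> 'x)" where
  "uniformity_defect E X Y \<rho> =
     (\<Sum>x\<in>UNIV. \<Sum>y\<in>UNIV. (pmf X x * pmf Y y) *\<^sub>R (ketbra (E x y) \<otimes> \<rho> y \<otimes> ketbra x)) -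
     maximally_mixed \<otimes> (\<Sum>x\<in>UNIV. \<Sum>y\<in>UNIV. (pmf X x * pmf Y y) *\<^sub>R (\<rho> y \<otimes> ketbra x))"

lemma uniformity_defect_eq:
  fixes E :: "'x::finite \<Rightarrow> 'y::finite \<Rightarrow> bit^'m::finite"
  shows "uniformity_defect E X Y \<rho> = (\<Sum>x\<in>UNIV. \<Sum>y\<in>UNIV. \<Sum>z\<in>UNIV.
    (pmf X x * pmf Y y * (of_bool (E x y = z) - 1 / 2 ^ CARD('m))) *\<^sub>R (ketbra z \<otimes> \<rho> y \<otimes> ketbra x))"
proof -
  have tensor_sum: "M \<otimes> (\<Sum>k\<in>K. c k *\<^sub>R N k) = (\<Sum>k\<in>K. c k *\<^sub>R (M \<otimes> N k))"
    for M :: "complex^'p^'p" and N :: "'k \<Rightarrow> complex^'q^'q" and c :: "'k \<Rightarrow> real" and K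
    by (induction K rule: infinite_finite_induct)
       (simp_all add: tensor_def vec_eq_iff algebra_simps scaleR_conv_of_real[where 'a = complex])
  have mixed: "(maximally_mixed :: complex^(bit^'m)^(bit^'m)) \<otimes> N = (\<Sum>z\<in>UNIV. (1 / 2 ^ CARD('m)) *\<^sub>R (ketbra z \<otimes> N))"
    for N :: "complex^'q^'q"
  proof -
    have "(\<Sum>z\<in>UNIV. ketbra z $ a $ b) = (mat 1 :: complex^(bit^'m)^(bit^'m)) $ a $ b" for a b
    proof -
      have "(\<Sum>z\<in>UNIV. ketbra z $ a $ b) = (\<Sum>z\<in>UNIV. if z = a then if b = a then 1 else 0 else 0)"
        by (intro sum.cong refl) (auto simp: ketbra_def)
      then show ?thesis
        by (simp add: mat_def)
    qed
    then show ?thesis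
      by (simp add: vec_eq_iff tensor_def maximally_mixed_def
          scaleR_conv_of_real[where 'a = complex] flip: sum_distrib_right sum_divide_distrib)
  qed
  have *: "(\<Sum>z\<in>UNIV. (p * (of_bool (e = z) - u)) *\<^sub>R K z) =
      p *\<^sub>R K e - p *\<^sub>R (\<Sum>z\<in>UNIV. u *\<^sub>R K z)"
    for p u :: real and e :: "bit^'m" and K :: "bit^'m \<Rightarrow> complex^'q^'q"
  proof -
    have "(\<Sum>z\<in>UNIV. (p * (of_bool (e = z) - u)) *\<^sub>R K z) =
        (\<Sum>z\<in>UNIV. (if z = e then p *\<^sub>R K e else 0) - p *\<^sub>R u *\<^sub>R K z)"
      by (intro sum.cong refl) (auto simp: algebra_simps)
    then show ?thesis
      by (simp add: sum_subtractf scaleR_sum_right)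
  qed
  have "maximally_mixed \<otimes> (\<Sum>x\<in>UNIV. \<Sum>y\<in>UNIV. (pmf X x * pmf Y y) *\<^sub>R (\<rho> y \<otimes> ketbra x)) =
      (\<Sum>x\<in>UNIV. \<Sum>y\<in>UNIV. (pmf X x * pmf Y y) *\<^sub>R
        (\<Sum>z\<in>UNIV. (1 / 2 ^ CARD('m)) *\<^sub>R ((ketbra z :: complex^(bit^'m)^(bit^'m)) \<otimes> \<rho> y \<otimes> ketbra x)))"
    unfolding mixed[symmetric] sum.cartesian_product
    using tensor_sum[of maximally_mixed "\<lambda>(x, y). pmf X x * pmf Y y" "\<lambda>(x, y). \<rho> y \<otimes> ketbra x"
        "UNIV \<times> UNIV"]
    by (simp add: case_prod_unfold)
  then show ?thesis
    by (simp add: uniformity_defect_def * sum_subtractf)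
qed

lemma hermitian_ketbra: "hermitian (ketbra x)"
  by (auto simp: dagger_def ketbra_def vec_eq_iff)

lemma hermitian_tensor: "hermitian M \<Longrightarrow> hermitian N \<Longrightarrow> hermitian (M \<otimes> N)"
  by (simp add: dagger_def tensor_def vec_eq_iff)

theorem trace_norm_uniformity_defect:
  fixes E :: "'x::finite \<Rightarrow> 'y::finite \<Rightarrow> bit^'m::finite" and \<rho> :: "'y \<Rightarrow> complex^'b::finite^'b"
  assumes orth: "\<And>S x x'. S \<noteq> {} \<Longrightarrow> x \<noteq> x' \<Longrightarrow> (\<Sum>y\<in>UNIV. character S (E x y) * character S (E x' y)) = 0"
    and X: "\<And>x. pmf X x \<le> 2 powr - k1"
    and \<rho>: "\<And>y. density_matrix (\<rho> y)" and Y: "guessing_entropy Y \<rho> \<ge> k2"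
  shows "trace_norm (uniformity_defect E X Y \<rho>)
    \<le> 2 ^ CARD('m) / 2 * sqrt (min 1 (CARD('y) * 2 powr - (k1 + k2)))"
proof -
  let ?D = "uniformity_defect E X Y \<rho>" and ?n = "2 ^ CARD('m) :: real"
  have "hermitian ?D"
    unfolding uniformity_defect_eq using \<rho>
    by (simp add: dagger_sum dagger_scaleR hermitian_tensor hermitian_ketbra psd_imp_hermitian
        density_matrix_def)
  then obtain T where T: "hermitian T" "contraction T"
    and tn: "trace_norm ?D = 1/2 * Re (trace (T ** ?D))"
    by (rule trace_norm_hermitian)
  let ?t = "\<lambda>x y z. Re (trace (diagonal_block z x T ** \<rho> y))"
  \<comment> \<open>The sign \<open>character S z\<close> is absorbed into the operator:
    \<open>2 ^ CARD('m)\<close> contractions with weights of modulus \<open>1 / 2 ^ CARD('m)\<close>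
    combine to a contraction.\<close>
  define U where "U S x = (\<Sum>z\<in>UNIV. (character S z / ?n) *\<^sub>R diagonal_block z x T)" for S x
  have U: "hermitian (U S x)" "contraction (U S x)" for S x
    unfolding U_def using T
    by (auto intro!: hermitian_sum_scaleR contraction_sum_scaleR
        simp: hermitian_diagonal_block contraction_diagonal_block abs_character )
  have "Re (trace (T ** ?D)) = (\<Sum>x\<in>UNIV. \<Sum>y\<in>UNIV. \<Sum>z\<in>UNIV.
      pmf X x * pmf Y y * (of_bool (E x y = z) - 1 / ?n) * ?t x y z)"
    by (simp add: uniformity_defect_eq matrix_mult_sum_right matrix_mult_scaleR_right trace_sum
        trace_scaleR trace_mult_block)
  also have "\<dots> = (\<Sum>x\<in>UNIV. \<Sum>y\<in>UNIV. \<Sum>S\<in>UNIV - {{}}.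
      pmf X x * pmf Y y * character S (E x y) * Re (trace (U S x ** \<rho> y)))"
  proof (intro sum.cong refl)
    fix x y
    have "(\<Sum>z\<in>UNIV. pmf X x * pmf Y y * (of_bool (E x y = z) - 1 / ?n) * ?t x y z) =
        (\<Sum>z\<in>UNIV. \<Sum>S\<in>UNIV - {{}}. pmf X x * pmf Y y * character S (E x y) * (character S z / ?n * ?t x y z))"
      unfolding indicator_minus_uniform
      by (simp add: sum_distrib_left sum_distrib_right sum_divide_distrib mult_ac)
    also have "\<dots> = (\<Sum>S\<in>UNIV - {{}}.
        pmf X x * pmf Y y * character S (E x y) * Re (trace (U S x ** \<rho> y)))"
      by (subst sum.swap) (simp add: U_def matrix_mult_sum_left matrix_mult_scaleR_left trace_sum
          trace_scaleR sum_distrib_left)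
    finally show "(\<Sum>z\<in>UNIV. pmf X x * pmf Y y * (of_bool (E x y = z) - 1 / ?n) * ?t x y z) = \<dots>" .
  qed
  also have "\<dots> = (\<Sum>S\<in>UNIV - {{}}. \<Sum>x\<in>UNIV. \<Sum>y\<in>UNIV.
      pmf X x * pmf Y y * character S (E x y) * Re (trace (U S x ** \<rho> y)))"
    by (subst (2) sum.swap, subst sum.swap) (rule refl)
  also have "\<dots> \<le> (\<Sum>S\<in>UNIV - {{}::'m set}. sqrt (min 1 (CARD('y) * 2 powr - (k1 + k2))))"
    using orth by (intro sum_mono correlation_bound[OF _ _ U X \<rho> Y]) (auto simp: character_square)
  also have "\<dots> = card (UNIV - {{}::'m set}) * sqrt (min 1 (CARD('y) * 2 powr - (k1 + k2)))"
    by simp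
  also have "\<dots> \<le> ?n * sqrt (min 1 (CARD('y) * 2 powr - (k1 + k2)))"
  proof (intro mult_right_mono)
    have "card (UNIV - {{}::'m set}) \<le> card (Pow (UNIV :: 'm set))"
      by (intro card_mono) auto
    then show "real (card (UNIV - {{}::'m set})) \<le> ?n"
      by (simp add: card_Pow)
  qed simp
  finally show ?thesis
    unfolding tn by simp
qed

section \<open>The DEOR extractor\<close>

lemma bit_vec_add_eq_0_iff: "x + x' = 0 \<longleftrightarrow> x = x'" for x x' :: "bit^'n"
proof -
  have "a + b = 0 \<longleftrightarrow> a = b" for a b :: bit
    by (cases a; cases b) simp_all
  then show ?thesis
    by (simp add: vec_eq_iff)
qed

text \<open>Adding \<open>axis j 1\<close>, where \<open>w $ j = 1\<close>, permutes the
  \<open>y\<close> and flips every sign, so the sum equals its own negative.\<close>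

lemma sum_bit_sign_scalar_product:
  fixes w :: "bit^'n"
  assumes "w \<noteq> 0"
  shows "(\<Sum>y\<in>UNIV. bit_sign (scalar_product w y)) = 0"
proof -
  obtain j where j: "w $ j = 1"
    using assms by (auto simp: vec_eq_iff)
  have neg: "bit_sign (scalar_product w (y + axis j 1)) = - bit_sign (scalar_product w y)" for y
  proof -
    have "scalar_product w (y + axis j 1) = scalar_product w y + scalar_product w (axis j 1)"
      by (simp add: scalar_product_def distrib_left sum.distrib)
    moreover have "scalar_product w (axis j 1) = 1"
      using j by (simp add: scalar_product_def axis_def if_distrib cong: if_cong)
    ultimately show ?thesis
      by (simp add: bit_sign_add) (simp add: bit_sign_def)
  qed
  have "bij (\<lambda>y. y + axis j (1::bit))"
    by (rule bij_betw_byWitness[where f' = "\<lambda>y. y + axis j 1"])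
       (auto simp: add.assoc bit_vec_add_eq_0_iff[THEN iffD2])
  then have "(\<Sum>y\<in>UNIV. bit_sign (scalar_product w y)) =
      (\<Sum>y\<in>UNIV. bit_sign (scalar_product w (y + axis j 1)))"
    by (rule sum.reindex_bij_betw[symmetric])
  then show ?thesis
    by (simp add: neg sum_negf)
qed

text \<open>Full row rank means that the rows span, which gives a left inverse and hence
  injectivity; surjectivity follows because the space is finite.\<close>

lemma full_rank_imp_bij:
  fixes M :: "bit^'n^'n"
  assumes "rank M = CARD('n)"
  shows "bij ((*v) M)"
proof -
  have "vec.span (rows M) = UNIV"
    using assms
    by (simp add: row_rank_def_gen card_cart_basis vec.dimension_def flip: vec.dim_eq_full)
  then obtain B where "B ** M = mat 1"
    using matrix_left_invertible_span_rows_gen by blast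
  then have "inj ((*v) M)"
    by (metis injI matrix_vector_mul_assoc matrix_vector_mul_lid)
  then show ?thesis
    by (simp add: bij_def finite_UNIV_inj_surj)
qed

text \<open>By linearity a character of the output is a single inner product, governed by the very
  matrix sum whose rank is assumed to be full.\<close>

lemma character_DEOR: "character S (DEOR A x y) = bit_sign (scalar_product ((\<Sum>i\<in>S. A i) *v x) y)"
proof -
  have "scalar_product ((\<Sum>i\<in>S. A i) *v x) y = (\<Sum>i\<in>S. scalar_product (A i *v x) y)"
    by (induction S rule: infinite_finite_induct)
       (simp_all add: scalar_product_def matrix_vector_mult_add_rdistrib distrib_right sum.distrib)
  then show ?thesis
    by (simp add: character_sum DEOR_def)
qed

lemma scalar_product_add:
  "scalar_product (u + v) w = scalar_product u w + scalar_product v w"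
  "scalar_product w (u + v) = scalar_product w u + scalar_product w v"
  by (simp_all add: scalar_product_def distrib_left distrib_right sum.distrib)

text \<open>The two signs multiply to the sign of an inner product with
  \<open>?M *v x + ?M *v x'\<close>, which is nonzero by injectivity and characteristic 2.\<close>

lemma DEOR_orthogonal_left:
  fixes A :: "'m::finite \<Rightarrow> bit^'n^'n"
  assumes "rank (\<Sum>i\<in>S. A i) = CARD('n)" "x \<noteq> x'"
  shows "(\<Sum>y\<in>UNIV. character S (DEOR A x y) * character S (DEOR A x' y)) = 0"
proof -
  let ?M = "\<Sum>i\<in>S. A i"
  have "?M *v x \<noteq> ?M *v x'"
    using full_rank_imp_bij[OF assms(1)] assms(2) by (auto simp: bij_def inj_def)
  then have "?M *v x + ?M *v x' \<noteq> 0"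
    by (simp add: bit_vec_add_eq_0_iff)
  from sum_bit_sign_scalar_product[OF this] show ?thesis
    by (simp add: character_DEOR scalar_product_add bit_sign_add)
qed

text \<open>Now \<open>x\<close> is the summation variable: bijectivity lets its image under the
  matrix sum be replaced by a free vector \<open>u\<close>.\<close>

lemma DEOR_orthogonal_right:
  fixes A :: "'m::finite \<Rightarrow> bit^'n^'n"
  assumes "rank (\<Sum>i\<in>S. A i) = CARD('n)" "y \<noteq> y'"
  shows "(\<Sum>x\<in>UNIV. character S (DEOR A x y) * character S (DEOR A x y')) = 0"
proof -
  have commute: "scalar_product u v = scalar_product v u" for u v :: "bit^'n"
    by (simp add: scalar_product_def mult.commute)
  have "(\<Sum>x\<in>UNIV. character S (DEOR A x y) * character S (DEOR A x y')) =
      (\<Sum>x\<in>UNIV. bit_sign (scalar_product ((\<Sum>i\<in>S. A i) *v x) (y + y')))"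
    by (simp add: character_DEOR scalar_product_add bit_sign_add)
  also have "\<dots> = (\<Sum>u\<in>UNIV. bit_sign (scalar_product u (y + y')))"
    by (rule sum.reindex_bij_betw[OF full_rank_imp_bij[OF assms(1)]])
  also have "\<dots> = 0"
    using sum_bit_sign_scalar_product[of "y + y'"] assms(2)
    by (simp add: commute bit_vec_add_eq_0_iff)
  finally show ?thesis .
qed

section \<open>From the entropy condition to the error, and the two strong forms\<close>

lemma extractor_error_bound:
  fixes k1 k2 \<epsilon> :: real and m n :: nat
  assumes "\<epsilon> > 0" and k: "k1 + k2 \<ge> 6 * real m + real n - 2 + 6 * log 2 (1 / \<epsilon>)"
  shows "2 ^ m / 2 * sqrt (min 1 (2 ^ n * 2 powr - (k1 + k2))) \<le> \<epsilon>"
proof (cases "\<epsilon> \<le> 2 ^ m")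
  \<comment> \<open>An error above \<open>2 ^ m\<close> is covered by the term 1 of the minimum
    alone.\<close>
  case False
  have "2 ^ m / 2 * sqrt (min 1 (2 ^ n * 2 powr - (k1 + k2))) \<le> (2 ^ m / 2 * 1 :: real)"
    by (intro mult_left_mono) auto
  also have "\<dots> \<le> 2 ^ m"
    by simp
  finally show ?thesis
    using False by linarith
next
  case True
  then have "log 2 \<epsilon> \<le> m"
    using \<open>\<epsilon> > 0\<close> by (simp add: log_le_iff powr_realpow)
  have "2 ^ n * 2 powr - (k1 + k2) \<le> 2 powr (real n - (6 * real m + real n - 2 + 6 * log 2 (1 / \<epsilon>)))"
    using k by (simp flip: powr_realpow powr_add)
  also have "real n - (6 * real m + real n - 2 + 6 * log 2 (1 / \<epsilon>)) = 2 * (3 * log 2 \<epsilon> + 1 - 3 * m)"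
    using \<open>\<epsilon> > 0\<close> by (simp add: log_divide)
  finally have "sqrt (2 ^ n * 2 powr - (k1 + k2)) \<le> sqrt ((2 powr (3 * log 2 \<epsilon> + 1 - 3 * m))\<^sup>2)"
    by (simp add: powr_power mult.commute)
  then have "sqrt (min 1 (2 ^ n * 2 powr - (k1 + k2))) \<le> 2 powr (3 * log 2 \<epsilon> + 1 - 3 * m)"
    by (smt (verit) powr_ge_zero real_sqrt_abs real_sqrt_le_mono)
  then have "2 ^ m / 2 * sqrt (min 1 (2 ^ n * 2 powr - (k1 + k2)))
      \<le> 2 ^ m / 2 * 2 powr (3 * log 2 \<epsilon> + 1 - 3 * m)"
    by (intro mult_left_mono) auto
  \<comment> \<open>This is \<epsilon> times the square of \<open>\<epsilon> / 2 ^ m\<close>, and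
    the case assumption makes that square at most 1.\<close>
  also have "\<dots> = 2 powr (log 2 \<epsilon> + 2 * (log 2 \<epsilon> - m))"
  proof -
    have "2 ^ m / 2 = (2 powr (real m - 1) :: real)"
      by (simp add: powr_diff powr_realpow)
    then show ?thesis
      by (simp add: algebra_simps flip: powr_add)
  qed
  also have "\<dots> \<le> 2 powr (log 2 \<epsilon>)"
    using \<open>log 2 \<epsilon> \<le> m\<close> by (intro powr_mono) auto
  also have "\<dots> = \<epsilon>"
    using \<open>\<epsilon> > 0\<close> by simp
  finally show ?thesis .
qed

theorem lemma28:
  fixes A :: "'m::finite \<Rightarrow> bit^'n::finite^'n" and k1 k2 \<epsilon> :: real
  assumes "CARD('n) \<ge> CARD('m)"
    and "\<And>S :: 'm set. S \<noteq> {} \<Longrightarrow> rank (\<Sum>i\<in>S. A i) = CARD('n)"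
    and "\<epsilon> > 0"
    and "k1 + k2 \<ge> 6 * real CARD('m) + real CARD('n) - 2 + 6 * log 2 (1 / \<epsilon>)"
  shows "X_strong_extractor TYPE('a::finite) TYPE('b::finite) k1 k2 \<epsilon> (DEOR A) \<and>
    Y_strong_extractor TYPE('a) TYPE('b) k1 k2 \<epsilon> (DEOR A)"
proof
  have bound: "2 ^ CARD('m) / 2 * sqrt (min 1 (CARD(bit^'n) * 2 powr - (k1 + k2))) \<le> \<epsilon>"
    using extractor_error_bound[OF assms(3,4)] by simp
  show "X_strong_extractor TYPE('a) TYPE('b) k1 k2 \<epsilon> (DEOR A)"
    unfolding X_strong_extractor_def uniformity_defect_def[symmetric]
  proof (intro allI impI)
    fix X Y :: "(bit^'n) pmf" and \<rho>X :: "bit^'n \<Rightarrow> complex^'a^'a" and \<rho>Y :: "bit^'n \<Rightarrow> complex^'b^'b"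
    assume \<rho>: "\<forall>x. density_matrix (\<rho>X x)" "\<forall>y. density_matrix (\<rho>Y y)"
      and k: "guessing_entropy X \<rho>X \<ge> k1" "guessing_entropy Y \<rho>Y \<ge> k2"
    have "trace_norm (uniformity_defect (DEOR A) X Y \<rho>Y)
        \<le> 2 ^ CARD('m) / 2 * sqrt (min 1 (CARD(bit^'n) * 2 powr - (k1 + k2)))"
      using assms(2) \<rho> k
      by (intro trace_norm_uniformity_defect DEOR_orthogonal_left pmf_le_guessing_entropy[of \<rho>X]) auto
    with bound show "trace_norm (uniformity_defect (DEOR A) X Y \<rho>Y) \<le> \<epsilon>"
      by linarith
  qed
  show "Y_strong_extractor TYPE('a) TYPE('b) k1 k2 \<epsilon> (DEOR A)"
    unfolding Y_strong_extractor_def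
  proof (intro allI impI)
    fix X Y :: "(bit^'n) pmf" and \<rho>X :: "bit^'n \<Rightarrow> complex^'a^'a" and \<rho>Y :: "bit^'n \<Rightarrow> complex^'b^'b"
    assume \<rho>: "\<forall>x. density_matrix (\<rho>X x)" "\<forall>y. density_matrix (\<rho>Y y)"
      and k: "guessing_entropy X \<rho>X \<ge> k1" "guessing_entropy Y \<rho>Y \<ge> k2"
    \<comment> \<open>The sources change places: now \<open>Y\<close> is revealed and the side
      information concerns \<open>X\<close>. The characters must then be orthogonal as functions of
      \<open>x\<close>, for distinct \<open>y\<close>.\<close>
    let ?D = "uniformity_defect (\<lambda>y x. DEOR A x y) Y X \<rho>X"
    have "trace_norm ?D \<le> 2 ^ CARD('m) / 2 * sqrt (min 1 (CARD(bit^'n) * 2 powr - (k2 + k1)))"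
      using assms(2) \<rho> k
      by (intro trace_norm_uniformity_defect DEOR_orthogonal_right pmf_le_guessing_entropy[of \<rho>Y]) auto
    with bound have "trace_norm ?D \<le> \<epsilon>"
      by (simp add: add.commute)
    moreover have "?D =
        (\<Sum>x\<in>UNIV. \<Sum>y\<in>UNIV. (pmf X x * pmf Y y) *\<^sub>R (ketbra (DEOR A x y) \<otimes> \<rho>X x \<otimes> ketbra y)) -
        maximally_mixed \<otimes> (\<Sum>x\<in>UNIV. \<Sum>y\<in>UNIV. (pmf X x * pmf Y y) *\<^sub>R (\<rho>X x \<otimes> ketbra y))"
      unfolding uniformity_defect_def by (subst (1 3) sum.swap) (simp add: mult.commute)
    ultimately show "trace_norm
        ((\<Sum>x\<in>UNIV. \<Sum>y\<in>UNIV. (pmf X x * pmf Y y) *\<^sub>R (ketbra (DEOR A x y) \<otimes> \<rho>X x \<otimes> ketbra y)) -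
        maximally_mixed \<otimes> (\<Sum>x\<in>UNIV. \<Sum>y\<in>UNIV. (pmf X x * pmf Y y) *\<^sub>R (\<rho>X x \<otimes> ketbra y))) \<le> \<epsilon>"
      by simp
  qed
qed

end
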